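(* For $x\in X^\jmath$ let $z\in\mathrm{GL}_n(E')$ be such that $x=z\bar z^{-1}$ and let $y=\jmath\star z={}^tz^\tau\jmath z\in Y_n(E)$. 1. Then, in fact, $y\in Y_n(F)$, and the assignment $G^\jmath(E)\cdot x\mapsto y\star\mathrm{GL}_n(F')$ is well defined and defines a bijection between the $G^\jmath(E)$-orbits in $X^\jmath$ and the $\mathrm{GL}_n(F')$-orbits in $\jmath\star\mathrm{GL}_n(E')\cap Y_n(F)$. 2. Furthermore, $G^\jmath_x(F)=zG^y(F)z^{-1}$.
   Context: $E/F$ is a quadratic extension of non-archimedean local fields of characteristic zero with Galois involution $\sigma(x)=\bar x$. Either $F'=F$ and $\tau=\mathrm{id}$ (symplectic or orthogonal case), or $F'/F$ is a quadratic extension with $E\cap F'=F$ and Galois involution $\tau$ (unitary case). $E'=EF'$, with $\sigma$ (resp. $\tau$) extended to $E'$ over $F'$ (resp. over $E$). $n\ge1$ and $\varepsilon\in\{\pm1\}$, with the convention that if $\varepsilon=-1$ then $F'=F$ and $n$ is even (symplectic case: $F'=F,\varepsilon=-1$; orthogonal case: $F'=F,\varepsilon=1$). $Y_n(E)=\{y\in\mathrm{GL}_n(E'):{}^ty^\tau=\varepsilon y\}$ and $Y_n(F)=Y_n(E)\cap\mathrm{GL}_n(F')$; $y\star g={}^tg^\tau yg$ is a right action of $\mathrm{GL}_n(E')$ on $Y_n(E)$ (and of $\mathrm{GL}_n(F')$ on $Y_n(F)$). For $\jmath\in Y_n(F)$: $G^\jmath(E)=\{g\in\mathrm{GL}_n(E'):{}^tg^\tau\jmath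 g=\jmath\}$, $G^\jmath(F)=G^\jmath(E)\cap\mathrm{GL}_n(F')$, $X^\jmath=\{x\in G^\jmath(E):x\bar x=I_n\}$ with $G^\jmath(E)$-action $g\cdot x=gx\bar g^{-1}$, and $G_x^\jmath(F)=\{g\in G^\jmath(E):g\cdot x=x\}$. By Hilbert 90 every $x\in\mathrm{GL}_n(E')$ with $x\bar x=I_n$ has the form $z\bar z^{-1}$ with $z\in\mathrm{GL}_n(E')$. Here $\jmath\in Y_n(F)$ is fixed. *)

theory Defs
  imports
    "HOL-Analysis.Analysis"
    "HOL-Algebra.Embedded_Algebras"
    "HOL-Algebra.Generated_Fields"
    "HOL-Algebra.Algebraic_Closure_Type"
begin

section \<open>Fields\<close>

text \<open>The largest field under consideration is a type; its subfields are sets of that type.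
  They are handled through the HOL-Algebra ring attached to the type.\<close>

abbreviation type_ring :: "'a::field ring"
  where "type_ring \<equiv> ring_of_type_algebra"

text \<open>A non-archimedean local field is a field that is locally compact for the topology of some
  nontrivial non-archimedean absolute value. The values of \<open>v\<close> outside \<open>K\<close> are irrelevant, since
  the balls generating \<open>Metric_space.mtopology K d\<close> only involve points of \<open>K\<close>.\<close>

definition nonarch_abs_value :: "'a::field set \<Rightarrow> ('a \<Rightarrow> real) \<Rightarrow> bool"
  where "nonarch_abs_value K v \<longleftrightarrow>
    (\<forall>x\<in>K. 0 \<le> v x \<and> (v x = 0 \<longleftrightarrow> x = 0)) \<and>
    (\<forall>x\<in>K. \<forall>y\<in>K. v (x * y) = v x * v y) \<and>
    (\<forall>x\<in>K. \<forall>y\<in>K. v (x + y) \<le> max (v x) (v y))"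

definition nonarch_local_field :: "'a::field set \<Rightarrow> bool"
  where "nonarch_local_field K \<longleftrightarrow>
    subfield K type_ring \<and>
    (\<exists>v. nonarch_abs_value K v \<and> (\<exists>x\<in>K. x \<noteq> 0 \<and> v x \<noteq> 1) \<and>
         locally_compact_space (Metric_space.mtopology K (\<lambda>x y. v (x - y))))"

definition quadratic_extension :: "'a::field set \<Rightarrow> 'a set \<Rightarrow> bool"
  where "quadratic_extension K L \<longleftrightarrow>
    subfield K type_ring \<and> subfield L type_ring \<and> K \<subseteq> L \<and> ring.dimension type_ring 2 K L"

text \<open>The nontrivial \<open>K\<close>-automorphism of a quadratic extension \<open>L\<close> of \<open>K\<close>. Only the values of \<open>s\<close>
  on \<open>L\<close> matter, so one function may be a Galois involution of several extensions.\<close>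

definition galois_involution :: "'a::field set \<Rightarrow> 'a set \<Rightarrow> ('a \<Rightarrow> 'a) \<Rightarrow> bool"
  where "galois_involution K L s \<longleftrightarrow>
    s \<in> ring_iso (type_ring\<lparr>carrier := L\<rparr>) (type_ring\<lparr>carrier := L\<rparr>) \<and>
    (\<forall>x\<in>K. s x = x) \<and> (\<exists>x\<in>L. s x \<noteq> x)"

section \<open>Matrix groups and spaces\<close>

definition Mat :: "'a set \<Rightarrow> ('a^'n^'n) set"
  where "Mat K = {g. \<forall>i j. g $ i $ j \<in> K}"

definition GL :: "'a::field set \<Rightarrow> ('a^'n^'n) set"
  where "GL K = {g \<in> Mat K. \<exists>h \<in> Mat K. g ** h = mat 1 \<and> h ** g = mat 1}"

text \<open>Below, matrices over the whole type are matrices over \<open>E'\<close>, and \<open>K\<close> is \<open>F'\<close> (or \<open>UNIV\<close>,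
  for orbits under \<open>GL_n(E')\<close>); a suffix \<open>_E\<close> or \<open>_F\<close> refers to points over \<open>E'\<close> or \<open>F'\<close>.\<close>

definition star :: "('a::field \<Rightarrow> 'a) \<Rightarrow> 'a^'n^'n \<Rightarrow> 'a^'n^'n \<Rightarrow> 'a^'n^'n"
  where "star \<tau> y g = transpose (map_matrix \<tau> g) ** y ** g"

definition Y_E :: "('a::field \<Rightarrow> 'a) \<Rightarrow> 'a \<Rightarrow> ('a^'n^'n) set"
  where "Y_E \<tau> \<epsilon> = {y \<in> GL UNIV. transpose (map_matrix \<tau> y) = map_matrix ((*) \<epsilon>) y}"

definition Y_F :: "'a::field set \<Rightarrow> ('a \<Rightarrow> 'a) \<Rightarrow> 'a \<Rightarrow> ('a^'n^'n) set"
  where "Y_F K \<tau> \<epsilon> = Y_E \<tau> \<epsilon> \<inter> GL K"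

definition G_E :: "('a::field \<Rightarrow> 'a) \<Rightarrow> 'a^'n^'n \<Rightarrow> ('a^'n^'n) set"
  where "G_E \<tau> y = {g \<in> GL UNIV. star \<tau> y g = y}"

definition G_F :: "'a::field set \<Rightarrow> ('a \<Rightarrow> 'a) \<Rightarrow> 'a^'n^'n \<Rightarrow> ('a^'n^'n) set"
  where "G_F K \<tau> y = G_E \<tau> y \<inter> GL K"

definition X_sp :: "('a::field \<Rightarrow> 'a) \<Rightarrow> ('a \<Rightarrow> 'a) \<Rightarrow> 'a^'n^'n \<Rightarrow> ('a^'n^'n) set"
  where "X_sp \<sigma> \<tau> y = {x \<in> G_E \<tau> y. x ** map_matrix \<sigma> x = mat 1}"

definition twisted_conj :: "('a::field \<Rightarrow> 'a) \<Rightarrow> 'a^'n^'n \<Rightarrow> 'a^'n^'n \<Rightarrow> 'a^'n^'n"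
  where "twisted_conj \<sigma> g x = g ** x ** matrix_inv (map_matrix \<sigma> g)"

definition stabilizer_F ::
    "('a::field \<Rightarrow> 'a) \<Rightarrow> ('a \<Rightarrow> 'a) \<Rightarrow> 'a^'n^'n \<Rightarrow> 'a^'n^'n \<Rightarrow> ('a^'n^'n) set"
  where "stabilizer_F \<sigma> \<tau> y x = {g \<in> G_E \<tau> y. twisted_conj \<sigma> g x = x}"

definition G_orbit ::
    "('a::field \<Rightarrow> 'a) \<Rightarrow> ('a \<Rightarrow> 'a) \<Rightarrow> 'a^'n^'n \<Rightarrow> 'a^'n^'n \<Rightarrow> ('a^'n^'n) set"
  where "G_orbit \<sigma> \<tau> y x = {twisted_conj \<sigma> g x | g. g \<in> G_E \<tau> y}"

definition star_orbit :: "'a::field set \<Rightarrow> ('a \<Rightarrow> 'a) \<Rightarrow> 'a^'n^'n \<Rightarrow> ('a^'n^'n) set"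
  where "star_orbit K \<tau> y = {star \<tau> y g | g. g \<in> GL K}"

end

theory Submission
  imports Defs
begin

text \<open>Write \<open>J \<star> w\<close> for \<open>star \<tau> J w\<close> and call \<open>w (\<sigma> w)\<^sup>-\<^sup>1\<close> the coboundary of an invertible
  matrix \<open>w\<close> over \<open>E'\<close>. Everything rests on comparing two maps defined on the same group:
  \<^item> \<open>w \<mapsto> w (\<sigma> w)\<^sup>-\<^sup>1\<close>, whose fibres are the cosets \<open>w GL_n(F')\<close>, because \<open>F'\<close> is the fixed
    field of \<open>\<sigma>\<close>;
  \<^item> \<open>w \<mapsto> J \<star> w\<close>, whose fibres are the cosets \<open>G\<^sup>J(E) w\<close>.

  Applying \<open>\<sigma>\<close> to \<open>J \<star> w\<close> shows that the coboundary of \<open>w\<close> lies in \<open>X\<^sup>J\<close> exactly when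
  \<open>J \<star> w\<close> has entries in \<open>F'\<close> (\<open>coboundary_in_X_iff\<close>), so both maps restrict to one set \<open>Z\<close>
  of matrices. The first map is equivariant for left multiplication by \<open>G\<^sup>J(E)\<close> and the second for
  right multiplication by \<open>GL_n(F')\<close>. The preimage in \<open>Z\<close> of an orbit on either side is therefore a
  double coset \<open>G\<^sup>J(E) z GL_n(F')\<close> (\<open>double_coset\<close>), and both sets of orbits are in bijection
  with these double cosets. Here Hilbert 90 (\<open>hilbert_90\<close>) ensures that the first
  map is onto \<open>X\<^sup>J\<close>, so that no orbit is missed. For the stabilizer formula, \<open>g\<close> fixes the coboundary
  of \<open>z\<close> exactly when \<open>g z = z h\<close> with \<open>h\<close> in \<open>GL_n(F')\<close>, and then \<open>g\<close> preserves \<open>J\<close> exactly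
  when \<open>h\<close> preserves \<open>J \<star> z\<close>.

  It remains to see that \<open>\<sigma>\<close> and \<open>\<tau>\<close> are commuting involutions of \<open>E'\<close> and that \<open>\<sigma>\<close> has fixed
  field \<open>F'\<close> (\<open>compositum_involutions\<close>). For this, \<open>E\<close> contains an element \<open>d \<notin> F\<close> with
  \<open>\<sigma> d = - d\<close> and \<open>d\<^sup>2 \<in> F\<close>; then \<open>E' = F' + F' d\<close>, and all claims can be read off from
  \<open>\<sigma> (u + v d) = u - v d\<close> and \<open>\<tau> (u + v d) = \<tau> u + \<tau> v d\<close>.\<close>

section \<open>Invertible matrices over a field\<close>

lemma invertible_matrix_inv:
  fixes A :: "'a::field^'n^'n"
  assumes "invertible A"
  shows "A ** matrix_inv A = mat 1" "matrix_inv A ** A = mat 1"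
  using someI_ex[OF assms[unfolded invertible_def]] unfolding matrix_inv_def by auto

lemma invertible_matrix_inv_invertible:
  fixes A :: "'a::field^'n^'n"
  assumes "invertible A"
  shows "invertible (matrix_inv A)"
  using invertible_matrix_inv[OF assms] unfolding invertible_def by blast

lemma invertible_cancel:
  fixes A B :: "'a::field^'n^'n"
  assumes "invertible A"
  shows "B ** A ** matrix_inv A = B" "B ** matrix_inv A ** A = B"
    "A ** (matrix_inv A ** B) = B" "matrix_inv A ** (A ** B) = B"
  using invertible_matrix_inv[OF assms] by (metis matrix_mul_assoc matrix_mul_rid matrix_mul_lid)+

lemma GL_UNIV: "g \<in> GL UNIV \<longleftrightarrow> invertible g"
  unfolding GL_def Mat_def invertible_def by auto

lemma map_matrix_transpose:
  "map_matrix f (transpose A) = transpose (map_matrix f A)"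
  by (simp add: vec_eq_iff transpose_def)

lemma map_matrix_scale_mult:
  fixes A B :: "'a::comm_semiring_1^'n^'n"
  shows "map_matrix ((*) c) A ** B = map_matrix ((*) c) (A ** B)"
    and "A ** map_matrix ((*) c) B = map_matrix ((*) c) (A ** B)"
  by (simp_all add: vec_eq_iff matrix_matrix_mult_def sum_distrib_left ac_simps)

lemma invertible_scale:
  fixes A :: "'a::field^'n^'n"
  assumes "c \<noteq> 0" "invertible A"
  shows "invertible (map_matrix ((*) c) A)"
proof -
  have *: "map_matrix ((*) a) (map_matrix ((*) b) B) = B" if "a * b = 1" for a b and B :: "'a^'n^'n"
    using that by (simp add: vec_eq_iff flip: mult.assoc)
  show ?thesis
    unfolding invertible_def
  proof (intro exI conjI)
    show "map_matrix ((*) c) A ** map_matrix ((*) (inverse c)) (matrix_inv A) = mat 1"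
      and "map_matrix ((*) (inverse c)) (matrix_inv A) ** map_matrix ((*) c) A = mat 1"
      using assms by (simp_all add: map_matrix_scale_mult invertible_matrix_inv *)
  qed
qed

text \<open>The matrix \<open>1 + t x\<close> is singular exactly at the roots of the polynomial \<open>det (1 + T x)\<close>, which
  is nonzero since its value at \<open>0\<close> is \<open>1\<close>.\<close>

lemma finite_singular_perturbations:
  fixes x :: "'a::field^'n^'n"
  shows "finite {t. \<not> invertible (mat 1 + map_matrix ((*) t) x)}"
proof -
  define P :: "'a poly^'n^'n" where "P = mat 1 + map_matrix (\<lambda>a. [:0, a:]) x"
  have P_entry: "poly (vec_nth (vec_nth P i) j) t = vec_nth (vec_nth (mat 1 + map_matrix ((*) t) x) i) j" for i j t
    by (simp add: P_def mat_def)
  have poly_det: "poly (det P) t = det (mat 1 + map_matrix ((*) t) x)" for t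
    unfolding det_def by (simp add: poly_sum poly_prod P_entry)
  have "mat 1 + map_matrix ((*) 0) x = mat 1"
    by (simp add: vec_eq_iff)
  then have "poly (det P) 0 = 1"
    by (simp add: poly_det)
  then have "det P \<noteq> 0"
    by auto
  then show ?thesis
    using poly_roots_finite[of "det P"] by (simp add: poly_det invertible_det_nz)
qed

section \<open>Coboundaries of a field involution and Hilbert 90\<close>

locale field_involution =
  fixes s :: "'a::field \<Rightarrow> 'a"
  assumes add: "s (x + y) = s x + s y"
    and mult: "s (x * y) = s x * s y"
    and invol: "s (s x) = x"
begin

lemma zero: "s 0 = 0"
  by (metis add add_cancel_left_right)

lemma one: "s 1 = 1"
  using mult[of "s 1" 1] by (simp add: invol)

lemma of_nat: "s (of_nat k) = of_nat k"
  by (induction k) (simp_all add: zero one add)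

lemma sum: "s (sum f I) = (\<Sum>i\<in>I. s (f i))"
  by (induction I rule: infinite_finite_induct) (simp_all add: zero add)

lemma map_matrix_mult: "map_matrix s (A ** B) = map_matrix s A ** map_matrix s B"
  by (simp add: vec_eq_iff matrix_matrix_mult_def sum mult)

lemma map_matrix_mat_1: "map_matrix s (mat 1) = mat 1"
  by (simp add: vec_eq_iff mat_def zero one)

lemma map_matrix_invol: "map_matrix s (map_matrix s A) = A"
  by (simp add: vec_eq_iff invol)

lemma invertible_map_matrix:
  fixes A :: "'a^'n^'n"
  assumes "invertible A"
  shows "invertible (map_matrix s A)"
  using assms unfolding invertible_def by (metis map_matrix_mult map_matrix_mat_1)

lemma map_matrix_inv:
  fixes A :: "'a^'n^'n"
  assumes "invertible A"
  shows "map_matrix s (matrix_inv A) = matrix_inv (map_matrix s A)"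
proof -
  have "map_matrix s (matrix_inv A) ** map_matrix s A = mat 1"
    using invertible_matrix_inv(2)[OF assms] by (metis map_matrix_mult map_matrix_mat_1)
  then show ?thesis
    using invertible_cancel(1)[OF invertible_map_matrix[OF assms]]
    by (metis matrix_mul_lid)
qed

lemma GL_fixed_field:
  fixes g :: "'a^'n^'n"
  shows
  "g \<in> GL {a. s a = a} \<longleftrightarrow> invertible g \<and> map_matrix s g = g"
proof
  assume "invertible g \<and> map_matrix s g = g"
  then have "invertible g" "map_matrix s g = g" "map_matrix s (matrix_inv g) = matrix_inv g"
    using map_matrix_inv[of g] by auto
  then show "g \<in> GL {a. s a = a}"
    using invertible_matrix_inv[of g] unfolding GL_def Mat_def
    by (auto simp: vec_eq_iff)
qed (auto simp: GL_def Mat_def invertible_def vec_eq_iff)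

text \<open>As \<open>s\<close> generates a group of order two, a \<open>1\<close>-cocycle with values in the general linear group
  amounts to a matrix \<open>x\<close> with \<open>x s(x) = 1\<close>; in this picture the following are the coboundaries.\<close>

definition coboundary :: "'a^'n^'n \<Rightarrow> 'a^'n^'n"
  where "coboundary z = z ** matrix_inv (map_matrix s z)"

lemma coboundary_eqI:
  assumes "invertible z" and "x ** map_matrix s z = z"
  shows "coboundary z = x"
  using invertible_cancel(1)[OF invertible_map_matrix[OF assms(1)]] assms(2)
  unfolding coboundary_def by metis

lemma coboundary_mult:
  assumes "invertible z"
  shows "coboundary z ** map_matrix s z = z"
  unfolding coboundary_def by (rule invertible_cancel(2)[OF invertible_map_matrix[OF assms]])

lemma coboundary_cocycle:
  assumes "invertible z"
  shows "coboundary z ** map_matrix s (coboundary z) = mat 1"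
proof -
  have "coboundary z ** map_matrix s (coboundary z) = coboundary z ** map_matrix s z ** matrix_inv z"
    using assms unfolding coboundary_def
    by (simp add: map_matrix_mult map_matrix_inv invertible_map_matrix map_matrix_invol matrix_mul_assoc)
  then show ?thesis
    using assms by (simp add: coboundary_mult invertible_matrix_inv)
qed

lemma coboundary_left_mult:
  assumes "invertible g" "invertible z"
  shows "coboundary (g ** z) = twisted_conj s g (coboundary z)"
proof (rule coboundary_eqI)
  show "invertible (g ** z)"
    using assms by (rule invertible_mult)
  have "twisted_conj s g (coboundary z) ** map_matrix s (g ** z)
      = g ** coboundary z ** (matrix_inv (map_matrix s g) ** (map_matrix s g ** map_matrix s z))"
    unfolding twisted_conj_def by (simp only: map_matrix_mult matrix_mul_assoc)
  also have "\<dots> = g ** (coboundary z ** map_matrix s z)"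
    using invertible_map_matrix[OF assms(1)] by (simp add: invertible_cancel matrix_mul_assoc)
  finally show "twisted_conj s g (coboundary z) ** map_matrix s (g ** z) = g ** z"
    using assms by (simp add: coboundary_mult)
qed

text \<open>If \<open>w\<close> and \<open>z\<close> have the same coboundary, then applying \<open>s\<close> to \<open>z\<^sup>-\<^sup>1 w\<close> changes nothing. So
  the fibres of the coboundary map are the cosets of the general linear group of the fixed field.\<close>

lemma coboundary_eq_iff:
  assumes "invertible w" "invertible z"
  shows "coboundary w = coboundary z \<longleftrightarrow> (\<exists>h\<in>GL {a. s a = a}. w = z ** h)"
proof
  assume eq: "coboundary w = coboundary z"
  define h where "h = matrix_inv z ** w"
  have w: "w = z ** h"
    unfolding h_def using assms by (simp add: invertible_cancel)
  have inv: "invertible h"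
    unfolding h_def using assms by (intro invertible_mult invertible_matrix_inv_invertible)
  have "z ** map_matrix s h = coboundary z ** map_matrix s w"
    unfolding w using assms by (simp add: map_matrix_mult coboundary_mult matrix_mul_assoc)
  also have "\<dots> = z ** h"
    using coboundary_mult[OF assms(1)] eq w by simp
  finally have "map_matrix s h = h"
    using invertible_cancel(4)[OF assms(2)] by metis
  then show "\<exists>h\<in>GL {a. s a = a}. w = z ** h"
    using inv w by (auto simp: GL_fixed_field)
next
  assume "\<exists>h\<in>GL {a. s a = a}. w = z ** h"
  then obtain h where "map_matrix s h = h" "w = z ** h"
    by (auto simp: GL_fixed_field)
  then show "coboundary w = coboundary z"
    using assms
    by (intro coboundary_eqI) (simp_all add: map_matrix_mult coboundary_mult matrix_mul_assoc)
qed

text \<open>For every matrix \<open>A\<close> the averaged matrix \<open>z = A + x s(A)\<close> satisfies \<open>x s(z) = z\<close>, so only the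
  invertibility of \<open>z\<close> is at stake. Scalar matrices \<open>A = c\<close> suffice: then \<open>z = c (1 + (s c / c) x)\<close>,
  which is invertible for all but finitely many values of \<open>s c / c\<close>. Starting from one element \<open>c\<^sub>0\<close>
  moved by \<open>s\<close>, the translates \<open>c = k + c\<^sub>0\<close> by natural numbers \<open>k\<close> give infinitely many such
  values. Characteristic zero enters as the distinctness of the numbers \<open>k\<close>.\<close>

lemma hilbert_90:
  fixes x :: "'a^'n^'n" and c\<^sub>0 :: 'a
  assumes char_0: "inj (of_nat :: nat \<Rightarrow> 'a)"
    and moved: "s c\<^sub>0 \<noteq> c\<^sub>0"
    and cocycle: "x ** map_matrix s x = mat 1"
  obtains z where "invertible z" "coboundary z = x"
proof -
  define c where "c k = of_nat k + c\<^sub>0" for k :: nat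
  have s_c: "s (c k) = of_nat k + s c\<^sub>0" for k
    by (simp add: c_def add of_nat)
  have c_nz: "c k \<noteq> 0" for k
  proof
    assume "c k = 0"
    then have "c\<^sub>0 = s c\<^sub>0"
      using s_c[of k] zero by (simp add: c_def) (metis add_left_cancel)
    then show False
      using moved by simp
  qed
  have "inj (\<lambda>k. s (c k) / c k)"
  proof (rule injI)
    fix k l assume "s (c k) / c k = s (c l) / c l"
    then have "(of_nat k + s c\<^sub>0) * c l = (of_nat l + s c\<^sub>0) * c k"
      using c_nz by (simp add: s_c field_simps)
    \<comment> \<open>Cross-multiplied, the difference of the two sides factors, and \<open>c\<^sub>0 - s c\<^sub>0\<close> is nonzero.\<close>
    then have "(of_nat k - of_nat l) * (c\<^sub>0 - s c\<^sub>0) = 0"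
      by (simp add: c_def algebra_simps)
    then show "k = l"
      using moved char_0 by (auto simp: inj_eq)
  qed
  then have "infinite (range (\<lambda>k. s (c k) / c k))"
    using range_inj_infinite by blast
  have "\<exists>k. invertible (mat 1 + map_matrix ((*) (s (c k) / c k)) x)"
  proof (rule ccontr)
    assume "\<not> ?thesis"
    then have "range (\<lambda>k. s (c k) / c k) \<subseteq> {t. \<not> invertible (mat 1 + map_matrix ((*) t) x)}"
      by auto
    then have "finite (range (\<lambda>k. s (c k) / c k))"
      by (rule finite_subset) (rule finite_singular_perturbations)
    with \<open>infinite (range (\<lambda>k. s (c k) / c k))\<close> show False
      by (rule notE)
  qed
  then obtain k where k: "invertible (mat 1 + map_matrix ((*) (s (c k) / c k)) x)" ..
  define z where "z = map_matrix ((*) (c k)) (mat 1) + map_matrix ((*) (s (c k))) x"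
  have "z = map_matrix ((*) (c k)) (mat 1 + map_matrix ((*) (s (c k) / c k)) x)"
    using c_nz[of k] by (simp add: z_def vec_eq_iff distrib_left)
  then have inv: "invertible z"
    using invertible_scale[OF c_nz k] by simp
  have map_z: "map_matrix s z = map_matrix ((*) (s (c k))) (mat 1) + map_matrix ((*) (c k)) (map_matrix s x)"
    by (simp add: z_def vec_eq_iff add mult invol mat_def zero one)
  have "x ** map_matrix s z = z"
    unfolding map_z matrix_add_ldistrib map_matrix_scale_mult cocycle
    by (simp add: z_def add.commute)
  then show thesis
    using that inv coboundary_eqI by blast
qed


end

section \<open>The congruence action on hermitian matrices\<close>

context field_involution
begin

lemma star_star: "star s (star s y g) h = star s y (g ** h)"
  by (simp add: star_def map_matrix_mult matrix_transpose_mul matrix_mul_assoc)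

lemma star_mat_1: "star s y (mat 1) = y"
  by (simp add: star_def map_matrix_mat_1 transpose_mat)

text \<open>Congruence by \<open>g\<close> is undone by congruence by the inverse of \<open>g\<close>.\<close>

lemma star_cancel_right:
  assumes "invertible g"
  shows "star s y g = star s y' g \<longleftrightarrow> y = y'"
proof
  assume "star s y g = star s y' g"
  then have "star s (star s y g) (matrix_inv g) = star s (star s y' g) (matrix_inv g)"
    by simp
  then show "y = y'"
    using assms by (simp add: star_star invertible_matrix_inv star_mat_1)
qed simp

lemma invertible_star:
  assumes "invertible y" "invertible g"
  shows "invertible (star s y g)"
  using assms invertible_map_matrix[OF assms(2)]
  by (simp add: star_def invertible_det_nz det_mul)

lemma star_in_Y_E:
  assumes "y \<in> Y_E s \<epsilon>" "invertible g"
  shows "star s y g \<in> Y_E s \<epsilon>"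
proof -
  have y: "invertible y" "transpose (map_matrix s y) = map_matrix ((*) \<epsilon>) y"
    using assms(1) by (auto simp: Y_E_def GL_UNIV)
  have "transpose (map_matrix s (star s y g)) = transpose (map_matrix s g) ** transpose (map_matrix s y) ** g"
    by (simp add: star_def map_matrix_mult map_matrix_transpose map_matrix_invol
        matrix_transpose_mul matrix_mul_assoc)
  also have "\<dots> = map_matrix ((*) \<epsilon>) (star s y g)"
    by (simp add: y(2) star_def map_matrix_scale_mult)
  finally show ?thesis
    using invertible_star[OF y(1) assms(2)] by (simp add: Y_E_def GL_UNIV)
qed

text \<open>If \<open>w\<close> and \<open>z\<close> transform \<open>y\<close> into the same form, then \<open>w z\<^sup>-\<^sup>1\<close> preserves \<open>y\<close>: the fibres of
  the orbit map of \<open>y\<close> are the cosets of its isometry group.\<close>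

lemma star_eq_iff:
  assumes "invertible w" "invertible z"
  shows "star s y w = star s y z \<longleftrightarrow> (\<exists>g\<in>G_E s y. w = g ** z)"
proof
  assume eq: "star s y w = star s y z"
  define g where "g = w ** matrix_inv z"
  have w: "w = g ** z"
    unfolding g_def using assms by (simp add: invertible_cancel)
  have "invertible g"
    unfolding g_def using assms by (intro invertible_mult invertible_matrix_inv_invertible)
  moreover have "star s (star s y g) z = star s y z"
    using eq w by (simp add: star_star)
  ultimately have "g \<in> G_E s y"
    using star_cancel_right[OF assms(2)] by (simp add: G_E_def GL_UNIV)
  then show "\<exists>g\<in>G_E s y. w = g ** z"
    using w by blast
next
  assume "\<exists>g\<in>G_E s y. w = g ** z"
  then show "star s y w = star s y z"
    by (auto simp: G_E_def simp flip: star_star)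
qed

end

section \<open>Orbits in the symmetric space\<close>

text \<open>The setting in which the correspondence of orbits is purely formal. The type stands for \<open>E'\<close>,
  and \<open>F'\<close> is given as the fixed field of \<open>\<sigma>\<close>.\<close>

locale symmetric_space = sigma: field_involution \<sigma> + tau: field_involution \<tau>
  for \<sigma> \<tau> :: "'a::field \<Rightarrow> 'a" +
  fixes \<epsilon> :: 'a and J :: "'a^'n^'n"
  assumes char_0: "inj (of_nat :: nat \<Rightarrow> 'a)"
    and nontrivial: "\<exists>d. \<sigma> d \<noteq> d"
    and commute: "\<sigma> (\<tau> x) = \<tau> (\<sigma> x)"
    and J: "J \<in> Y_F {a. \<sigma> a = a} \<tau> \<epsilon>"
begin

abbreviation K :: "'a set"
  where "K \<equiv> {a. \<sigma> a = a}"

lemma invertible_G_E: "g \<in> G_E \<tau> J \<Longrightarrow> invertible g"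
  by (simp add: G_E_def GL_UNIV)

lemma invertible_GL_K: "h \<in> GL K \<Longrightarrow> invertible h"
  by (simp add: sigma.GL_fixed_field)

lemma map_matrix_star:
  fixes y g :: "'a^'n^'n"
  shows "map_matrix \<sigma> (star \<tau> y g) = star \<tau> (map_matrix \<sigma> y) (map_matrix \<sigma> g)"
proof -
  have "map_matrix \<sigma> (map_matrix \<tau> g) = map_matrix \<tau> (map_matrix \<sigma> g)"
    by (simp add: vec_eq_iff commute)
  then show ?thesis
    by (simp add: star_def sigma.map_matrix_mult map_matrix_transpose)
qed

text \<open>Let \<open>x\<close> be the coboundary of \<open>z\<close>, so that \<open>z = x \<sigma>(z)\<close>. Congruence by \<open>\<sigma>(z)\<close> turns the
  equation \<open>J \<star> x = J\<close> into \<open>J \<star> z = J \<star> \<sigma>(z)\<close>. Since \<open>J\<close> has entries in the fixed field, the right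
  side is \<open>\<sigma>(J \<star> z)\<close>. Hence \<open>x\<close> preserves \<open>J\<close> exactly when \<open>J \<star> z\<close> is fixed by \<open>\<sigma>\<close>.\<close>

lemma coboundary_in_X_iff:
  assumes z: "invertible z"
  shows "sigma.coboundary z \<in> X_sp \<sigma> \<tau> J \<longleftrightarrow> star \<tau> J z \<in> Y_F K \<tau> \<epsilon>"
proof -
  have J: "invertible J" "map_matrix \<sigma> J = J" "J \<in> Y_E \<tau> \<epsilon>"
    using J by (auto simp: Y_F_def sigma.GL_fixed_field)
  define x where "x = sigma.coboundary z"
  have inv_z: "invertible (map_matrix \<sigma> z)"
    using z by (rule sigma.invertible_map_matrix)
  then have inv_x: "invertible x"
    unfolding x_def sigma.coboundary_def using z
    by (intro invertible_mult invertible_matrix_inv_invertible)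
  have "x \<in> X_sp \<sigma> \<tau> J \<longleftrightarrow> star \<tau> J x = J"
    using inv_x sigma.coboundary_cocycle[OF z] by (auto simp: X_sp_def G_E_def GL_UNIV x_def)
  also have "\<dots> \<longleftrightarrow> star \<tau> (star \<tau> J x) (map_matrix \<sigma> z) = star \<tau> J (map_matrix \<sigma> z)"
    using tau.star_cancel_right[OF inv_z] by blast
  also have "\<dots> \<longleftrightarrow> star \<tau> J z = map_matrix \<sigma> (star \<tau> J z)"
    using z by (simp add: x_def tau.star_star sigma.coboundary_mult map_matrix_star J(2))
  also have "\<dots> \<longleftrightarrow> star \<tau> J z \<in> Y_F K \<tau> \<epsilon>"
    using tau.star_in_Y_E[OF J(3) z] tau.invertible_star[OF J(1) z]
    by (auto simp: Y_F_def sigma.GL_fixed_field)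
  finally show ?thesis
    by (simp add: x_def)
qed

lemma X_coboundary:
  assumes "x \<in> X_sp \<sigma> \<tau> J"
  obtains z where "invertible z" "x = sigma.coboundary z"
  using assms nontrivial sigma.hilbert_90[OF char_0] unfolding X_sp_def by blast

lemma G_orbit_coboundary:
  assumes z: "invertible z"
  shows "G_orbit \<sigma> \<tau> J (sigma.coboundary z) = {sigma.coboundary (g ** z) | g. g \<in> G_E \<tau> J}"
proof -
  have "twisted_conj \<sigma> g (sigma.coboundary z) = sigma.coboundary (g ** z)" if "g \<in> G_E \<tau> J" for g
    using sigma.coboundary_left_mult[OF invertible_G_E[OF that] z] by simp
  then show ?thesis
    unfolding G_orbit_def by (intro Collect_cong) metis
qed

lemma star_orbit_star:
  "star_orbit K \<tau> (star \<tau> J z) = {star \<tau> J (z ** h) | h. h \<in> GL K}"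
  by (simp add: star_orbit_def tau.star_star)

text \<open>The next two operations transport sets of matrices between the symmetric space and the hermitian
  matrices, through all invertible \<open>w\<close> lying over them. Going through all \<open>w\<close> at once gives
  the bijection on orbits and its inverse without choosing representatives.\<close>

definition star_image :: "('a^'n^'n) set \<Rightarrow> ('a^'n^'n) set"
  where "star_image S = {star \<tau> J w | w. invertible w \<and> sigma.coboundary w \<in> S}"

definition coboundary_image :: "('a^'n^'n) set \<Rightarrow> ('a^'n^'n) set"
  where "coboundary_image S = {sigma.coboundary w | w. invertible w \<and> star \<tau> J w \<in> S}"

text \<open>Both kinds of orbit through the point defined by \<open>z\<close> have the same preimage among the invertible
  matrices, a double coset of \<open>z\<close>. The coset missing from the orbit is in each case supplied by the
  fibres of the map.\<close>

lemma double_coset: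
  assumes z: "invertible z" and w: "invertible w"
  shows "sigma.coboundary w \<in> G_orbit \<sigma> \<tau> J (sigma.coboundary z) \<longleftrightarrow>
      (\<exists>g\<in>G_E \<tau> J. \<exists>h\<in>GL K. w = g ** z ** h)"
    and "star \<tau> J w \<in> star_orbit K \<tau> (star \<tau> J z) \<longleftrightarrow>
      (\<exists>g\<in>G_E \<tau> J. \<exists>h\<in>GL K. w = g ** z ** h)"
proof -
  have "sigma.coboundary w = sigma.coboundary (g ** z) \<longleftrightarrow> (\<exists>h\<in>GL K. w = g ** z ** h)"
    if "g \<in> G_E \<tau> J" for g
    using sigma.coboundary_eq_iff[OF w invertible_mult[OF invertible_G_E[OF that] z]] .
  then show "sigma.coboundary w \<in> G_orbit \<sigma> \<tau> J (sigma.coboundary z) \<longleftrightarrow>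
      (\<exists>g\<in>G_E \<tau> J. \<exists>h\<in>GL K. w = g ** z ** h)"
    unfolding G_orbit_coboundary[OF z] by blast
  have "star \<tau> J w = star \<tau> J (z ** h) \<longleftrightarrow> (\<exists>g\<in>G_E \<tau> J. w = g ** z ** h)"
    if "h \<in> GL K" for h
    using tau.star_eq_iff[OF w invertible_mult[OF z invertible_GL_K[OF that]]]
    by (simp add: matrix_mul_assoc)
  then show "star \<tau> J w \<in> star_orbit K \<tau> (star \<tau> J z) \<longleftrightarrow>
      (\<exists>g\<in>G_E \<tau> J. \<exists>h\<in>GL K. w = g ** z ** h)"
    unfolding star_orbit_star by blast
qed

lemma star_image_G_orbit:
  assumes z: "invertible z"
  shows "star_image (G_orbit \<sigma> \<tau> J (sigma.coboundary z)) = star_orbit K \<tau> (star \<tau> J z)"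
proof -
  have "star_image (G_orbit \<sigma> \<tau> J (sigma.coboundary z))
      = {star \<tau> J w | w. invertible w \<and> star \<tau> J w \<in> star_orbit K \<tau> (star \<tau> J z)}"
    unfolding star_image_def using double_coset[OF z] by blast
  also have "\<dots> = star_orbit K \<tau> (star \<tau> J z)"
    unfolding star_orbit_star using invertible_mult[OF z] invertible_GL_K by blast
  finally show ?thesis .
qed

lemma coboundary_image_star_orbit:
  assumes z: "invertible z"
  shows "coboundary_image (star_orbit K \<tau> (star \<tau> J z)) = G_orbit \<sigma> \<tau> J (sigma.coboundary z)"
proof -
  have "coboundary_image (star_orbit K \<tau> (star \<tau> J z))
      = {sigma.coboundary w | w. invertible w \<and> sigma.coboundary w \<in> G_orbit \<sigma> \<tau> J (sigma.coboundary z)}"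
    unfolding coboundary_image_def using double_coset[OF z] by blast
  also have "\<dots> = G_orbit \<sigma> \<tau> J (sigma.coboundary z)"
    unfolding G_orbit_coboundary[OF z] using invertible_mult[OF _ z] invertible_G_E by blast
  finally show ?thesis .
qed

lemma bij_betw_star_image:
  "bij_betw star_image (G_orbit \<sigma> \<tau> J ` X_sp \<sigma> \<tau> J)
     (star_orbit K \<tau> ` (star_orbit UNIV \<tau> J \<inter> Y_F K \<tau> \<epsilon>))"
proof -
  define Z where "Z = {z. invertible z \<and> star \<tau> J z \<in> Y_F K \<tau> \<epsilon>}"
  have "X_sp \<sigma> \<tau> J = sigma.coboundary ` Z"
    using coboundary_in_X_iff X_coboundary unfolding Z_def by blast
  then have X: "G_orbit \<sigma> \<tau> J ` X_sp \<sigma> \<tau> J = (\<lambda>z. G_orbit \<sigma> \<tau> J (sigma.coboundary z)) ` Z"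
    by (simp add: image_image)
  have "star_orbit UNIV \<tau> J \<inter> Y_F K \<tau> \<epsilon> = star \<tau> J ` Z"
    unfolding Z_def star_orbit_def GL_UNIV by blast
  then have Y: "star_orbit K \<tau> ` (star_orbit UNIV \<tau> J \<inter> Y_F K \<tau> \<epsilon>)
      = (\<lambda>z. star_orbit K \<tau> (star \<tau> J z)) ` Z"
    by (simp add: image_image)
  show ?thesis
    unfolding X Y
    by (rule bij_betw_byWitness[where f' = coboundary_image])
      (auto simp: Z_def star_image_G_orbit coboundary_image_star_orbit)
qed

text \<open>By equivariance, \<open>g\<close> fixes the coboundary of \<open>z\<close> when \<open>g z\<close> and \<open>z\<close> have the same coboundary,
  that is, when \<open>g z = z h\<close> for some \<open>h\<close> over the fixed field. For such a pair, \<open>g\<close> preserves \<open>J\<close>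
  exactly when \<open>h\<close> preserves \<open>J \<star> z\<close>, because both say that \<open>J \<star> (g z) = J \<star> z\<close>.\<close>

lemma stabilizer_coboundary:
  assumes z: "invertible z"
  shows "stabilizer_F \<sigma> \<tau> J (sigma.coboundary z)
    = {z ** h ** matrix_inv z | h. h \<in> G_F K \<tau> (star \<tau> J z)}"
proof (intro equalityI subsetI)
  fix g assume "g \<in> stabilizer_F \<sigma> \<tau> J (sigma.coboundary z)"
  then have g: "g \<in> G_E \<tau> J" "sigma.coboundary (g ** z) = sigma.coboundary z"
    using sigma.coboundary_left_mult[OF _ z] invertible_G_E by (auto simp: stabilizer_F_def)
  then obtain h where h: "h \<in> GL K" "g ** z = z ** h"
    using sigma.coboundary_eq_iff[OF invertible_mult[OF invertible_G_E z] z] by blast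
  have "star \<tau> (star \<tau> J z) h = star \<tau> (star \<tau> J g) z"
    using h(2) by (simp add: tau.star_star)
  also have "\<dots> = star \<tau> J z"
    using g(1) by (simp add: G_E_def)
  finally have "h \<in> G_F K \<tau> (star \<tau> J z)"
    using h(1) invertible_GL_K by (simp add: G_F_def G_E_def GL_UNIV)
  moreover have "g = z ** h ** matrix_inv z"
    using invertible_cancel(1)[OF z, of g] h(2) by simp
  ultimately show "g \<in> {z ** h ** matrix_inv z | h. h \<in> G_F K \<tau> (star \<tau> J z)}"
    by blast
next
  fix g assume "g \<in> {z ** h ** matrix_inv z | h. h \<in> G_F K \<tau> (star \<tau> J z)}"
  then obtain h where h: "h \<in> GL K" "star \<tau> J (z ** h) = star \<tau> J z"
    and g: "g = z ** h ** matrix_inv z"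
    by (auto simp: G_F_def G_E_def tau.star_star)
  have gz: "g ** z = z ** h"
    unfolding g using z by (simp add: invertible_cancel)
  have zh: "invertible (z ** h)"
    using z invertible_GL_K[OF h(1)] by (rule invertible_mult)
  obtain g' where "g' \<in> G_E \<tau> J" "z ** h = g' ** z"
    using tau.star_eq_iff[OF zh z] h(2) by blast
  then have "g \<in> G_E \<tau> J"
    using invertible_cancel(1)[OF z] g by metis
  moreover have "sigma.coboundary (g ** z) = sigma.coboundary z"
    using sigma.coboundary_eq_iff[OF zh z] h(1) gz by auto
  ultimately show "g \<in> stabilizer_F \<sigma> \<tau> J (sigma.coboundary z)"
    using sigma.coboundary_left_mult[OF _ z] invertible_G_E by (simp add: stabilizer_F_def)
qed

end

section \<open>Quadratic extensions and their composita\<close>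

lemma type_ring_simps:
  "carrier (type_ring :: 'a::field ring) = UNIV"
  "\<zero>\<^bsub>type_ring\<^esub> = (0 :: 'a)"
  "\<one>\<^bsub>type_ring\<^esub> = (1 :: 'a)"
  "x \<oplus>\<^bsub>type_ring\<^esub> y = x + (y :: 'a)"
  "x \<otimes>\<^bsub>type_ring\<^esub> y = x * (y :: 'a)"
  by (simp_all add: ring_of_type_algebra_def)

lemma type_ring_a_inv: "\<ominus>\<^bsub>type_ring\<^esub> x = - (x :: 'a::field)"
  by (rule abelian_group.minus_equality)
    (auto simp: type_ring_simps intro: ring.is_abelian_group)

lemma type_ring_m_inv: "(x :: 'a::field) \<noteq> 0 \<Longrightarrow> inv\<^bsub>type_ring\<^esub> x = inverse x"
  by (rule comm_monoid.comm_inv_char[OF cring.axioms(2)[OF cring_from_type_algebra]])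
    (simp_all add: type_ring_simps)

lemma type_subfield_closed:
  fixes K :: "'a::field set"
  assumes "subfield K type_ring"
  shows "0 \<in> K" "1 \<in> K"
    and "\<And>x y. x \<in> K \<Longrightarrow> y \<in> K \<Longrightarrow> x + y \<in> K"
    and "\<And>x. x \<in> K \<Longrightarrow> - x \<in> K"
    and "\<And>x y. x \<in> K \<Longrightarrow> y \<in> K \<Longrightarrow> x - y \<in> K"
    and "\<And>x y. x \<in> K \<Longrightarrow> y \<in> K \<Longrightarrow> x * y \<in> K"
    and "\<And>x. x \<in> K \<Longrightarrow> inverse x \<in> K"
    and "\<And>x y. x \<in> K \<Longrightarrow> y \<in> K \<Longrightarrow> x / y \<in> K"
proof -
  interpret type_ring: field "type_ring :: 'a ring"
    by (rule field_from_type_algebra)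
  note E = subringE[OF subfieldE(1)[OF assms], unfolded type_ring_simps type_ring_a_inv]
  show zero: "0 \<in> K" and "1 \<in> K"
    using E(2,3) by auto
  show plus: "x + y \<in> K" if "x \<in> K" "y \<in> K" for x y
    using E(7) that by auto
  show uminus: "- x \<in> K" if "x \<in> K" for x
    using E(5) that by (auto simp: type_ring_a_inv)
  show "x - y \<in> K" if "x \<in> K" "y \<in> K" for x y
    using plus[OF that(1) uminus[OF that(2)]] by simp
  show mult: "x * y \<in> K" if "x \<in> K" "y \<in> K" for x y
    using E(6) that by auto
  show inverse: "inverse x \<in> K" if "x \<in> K" for x
    using that zero type_ring.subfield_m_inv(1)[OF assms, of x]
    by (cases "x = 0") (auto simp: type_ring_m_inv type_ring_simps)
  show "x / y \<in> K" if "x \<in> K" "y \<in> K" for x y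
    using mult[OF that(1) inverse[OF that(2)]] by (simp add: divide_inverse)
qed

lemma type_subfieldI:
  fixes K :: "'a::field set"
  assumes "1 \<in> K"
    and "\<And>x. x \<in> K \<Longrightarrow> - x \<in> K"
    and "\<And>x y. x \<in> K \<Longrightarrow> y \<in> K \<Longrightarrow> x + y \<in> K"
    and "\<And>x y. x \<in> K \<Longrightarrow> y \<in> K \<Longrightarrow> x * y \<in> K"
    and "\<And>x. x \<in> K \<Longrightarrow> x \<noteq> 0 \<Longrightarrow> inverse x \<in> K"
  shows "subfield K type_ring"
proof -
  interpret type_ring: field "type_ring :: 'a ring"
    by (rule field_from_type_algebra)
  show ?thesis
    by (intro type_ring.subfieldI' type_ring.subringI)
      (use assms in \<open>auto simp: type_ring_simps type_ring_a_inv type_ring_m_inv\<close>)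
qed

text \<open>The elements \<open>a\<close> and \<open>1\<close> are independent over \<open>K\<close>, hence span a space of dimension two.\<close>

lemma quadratic_extension_basis:
  fixes K L :: "'a::field set"
  assumes "quadratic_extension K L" "a \<in> L" "a \<notin> K" "x \<in> L"
  obtains u v where "u \<in> K" "v \<in> K" "x = u + v * a"
proof -
  interpret type_ring: field "type_ring :: 'a ring"
    by (rule field_from_type_algebra)
  have K: "subfield K type_ring" and L: "subfield L type_ring"
    and dim: "type_ring.dimension 2 K L"
    using assms(1) by (auto simp: quadratic_extension_def)
  have line: "type_ring.line_extension K b V = {k * b + v | k v. k \<in> K \<and> v \<in> V}"
    for b :: 'a and V
    by (fastforce simp: type_ring.line_extension_def set_add_def' r_coset_def type_ring_simps)
  have span_1: "type_ring.Span K [1] = K"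
    by (auto simp: line type_ring_simps)
  have "type_ring.independent K [a, 1]"
    by (intro type_ring.independent.intros)
      (use assms(3) span_1 in \<open>auto simp: type_ring_simps\<close>)
  then have "type_ring.Span K [a, 1] = L"
    using type_ring.independent_length_eq_dimension[OF K dim, of "[a, 1]"]
      assms(2) type_subfield_closed(2)[OF L] by auto
  moreover have "type_ring.Span K [a, 1] = type_ring.line_extension K a (type_ring.Span K [1])"
    by simp
  moreover have "\<dots> = {k * a + v | k v. k \<in> K \<and> v \<in> K}"
    by (simp only: span_1 line)
  ultimately show thesis
    using assms(4) that by (auto simp: add.commute)
qed


lemma galois_involution_hom:
  fixes s :: "'a::field \<Rightarrow> 'a"
  assumes "galois_involution K L s" "x \<in> L"
  shows "s x \<in> L"
    and "y \<in> L \<Longrightarrow> s (x + y) = s x + s y"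
    and "y \<in> L \<Longrightarrow> s (x * y) = s x * s y"
proof -
  have *: "s \<in> ring_hom (type_ring\<lparr>carrier := L\<rparr>) (type_ring\<lparr>carrier := L\<rparr>)"
    using assms(1) by (auto simp: galois_involution_def ring_iso_def)
  show "s x \<in> L"
    and "y \<in> L \<Longrightarrow> s (x + y) = s x + s y"
    and "y \<in> L \<Longrightarrow> s (x * y) = s x * s y"
    using ring_hom_closed[OF *, of x] ring_hom_add[OF *, of x y] ring_hom_mult[OF *, of x y] assms(2)
    by (simp_all add: type_ring_simps)
qed

lemma galois_involution_fixes: "galois_involution K L s \<Longrightarrow> x \<in> K \<Longrightarrow> s x = x"
  by (simp add: galois_involution_def)

text \<open>Take \<open>a\<close> with \<open>s a \<noteq> a\<close> and write \<open>a\<^sup>2 = p + q a\<close> over \<open>K\<close>. Then \<open>s a\<close> is the other root of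
  this equation, so \<open>s a = q - a\<close>, and completing the square gives \<open>d = a - q/2\<close>.\<close>

lemma quadratic_extension_odd_generator:
  fixes K L :: "'a::field_char_0 set"
  assumes quad: "quadratic_extension K L" and s: "galois_involution K L s"
  obtains d where "d \<in> L" "d \<notin> K" "d * d \<in> K" "s d = - d"
proof -
  have K: "subfield K type_ring" and L: "subfield L type_ring" and sub: "K \<subseteq> L"
    using quad by (auto simp: quadratic_extension_def)
  note K_closed = type_subfield_closed[OF K] and L_closed = type_subfield_closed[OF L]
  note hom = galois_involution_hom[OF s]
  note fixes_K = galois_involution_fixes[OF s]
  obtain a where a: "a \<in> L" "s a \<noteq> a"
    using s by (auto simp: galois_involution_def)
  then have "a \<notin> K"
    using fixes_K by metis
  have "a * a \<in> L"
    using a(1) by (simp add: L_closed)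
  with \<open>a \<notin> K\<close> obtain p q where pq: "p \<in> K" "q \<in> K" "a * a = p + q * a"
    using quadratic_extension_basis[OF quad a(1)] by metis
  have "s a * s a = s (p + q * a)"
    using hom(3)[OF a(1) a(1)] pq(3) by simp
  also have "\<dots> = s p + s q * s a"
    using hom(2)[of p "q * a"] hom(3)[of q a] pq a(1) subsetD[OF sub] by (simp add: L_closed)
  also have "\<dots> = p + q * s a"
    using fixes_K pq by simp
  finally have "(a - s a) * (a + s a - q) = 0"
    using pq(3) by (simp add: algebra_simps)
  then have "a + s a - q = 0"
    using a(2) by simp
  then have sa: "s a = q - a"
    by (simp add: algebra_simps)
  have "1 + 1 \<in> K"
    by (intro K_closed)
  then have half: "q / 2 \<in> K"
    using K_closed(8) pq(2) by simp
  define d where "d = a - q / 2"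
  show thesis
  proof
    show "d \<in> L"
      unfolding d_def using a(1) subsetD[OF sub half] by (rule L_closed)
    show "d \<notin> K"
      using \<open>a \<notin> K\<close> half K_closed(3)[of d "q / 2"] by (auto simp: d_def)
    have "d * d = p + (q / 2) * (q / 2)"
      using pq(3) by (simp add: d_def algebra_simps)
    then show "d * d \<in> K"
      using K_closed(3)[OF pq(1) K_closed(6)[OF half half]] by simp
    have "s d = s a + s (- (q / 2))"
      using hom(2)[OF a(1), of "- (q / 2)"] subsetD[OF sub K_closed(4)[OF half]] by (simp add: d_def)
    also have "s (- (q / 2)) = - (q / 2)"
      using fixes_K K_closed(4)[OF half] .
    finally show "s d = - d"
      by (simp add: sa d_def field_simps)
  qed
qed

text \<open>Closure under inverses comes from the norm: \<open>(u + v d)(u - v d) = u\<^sup>2 - v\<^sup>2 d\<^sup>2\<close> lies in \<open>K\<close>, and the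
  second factor cannot vanish because \<open>d\<close> is not in \<open>K\<close>.\<close>

lemma type_subfield_adjoin_sqrt:
  fixes K :: "'a::field set"
  assumes K: "subfield K type_ring" and d: "d \<notin> K" "d * d \<in> K"
  shows "subfield {u + v * d | u v. u \<in> K \<and> v \<in> K} type_ring" (is "subfield ?L _")
proof (rule type_subfieldI)
  note closed = type_subfield_closed[OF K]
  have L: "x \<in> ?L" if "x = u + v * d" "u \<in> K" "v \<in> K" for x u v
    using that by blast
  show "1 \<in> ?L"
    by (rule L[of _ 1 0]) (use closed in auto)
  fix x assume "x \<in> ?L"
  then obtain u v where x: "x = u + v * d" "u \<in> K" "v \<in> K"
    by blast
  show "- x \<in> ?L"
    by (rule L[of _ "- u" "- v"]) (use x closed in auto)
  show "inverse x \<in> ?L" if "x \<noteq> 0"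
  proof -
    define N where "N = u * u - v * v * (d * d)"
    have N: "N = (u - v * d) * x"
      by (simp add: N_def x algebra_simps)
    have "u - v * d \<noteq> 0"
    proof
      assume *: "u - v * d = 0"
      have "v = 0"
      proof (rule ccontr)
        assume "v \<noteq> 0"
        then have "d = u / v"
          using * by (simp add: field_simps)
        then show False
          using d(1) x closed by simp
      qed
      then show False
        using * that x by simp
    qed
    then have "inverse x = (u - v * d) / N"
      using N that by (simp add: divide_inverse)
    then have inverse_x: "inverse x = u / N + (- v / N) * d"
      by (simp add: diff_divide_distrib)
    have "N \<in> K"
      unfolding N_def using x(2,3) d(2) by (simp add: closed)
    then show ?thesis
      using x(2,3) by (intro L[OF inverse_x]) (simp_all only: closed)
  qed
  fix y assume "y \<in> ?L"
  then obtain u' v' where y: "y = u' + v' * d" "u' \<in> K" "v' \<in> K"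
    by blast
  show "x + y \<in> ?L"
  proof (rule L)
    show "x + y = (u + u') + (v + v') * d"
      by (simp add: x y algebra_simps)
  qed (use x y in \<open>simp_all only: closed\<close>)
  show "x * y \<in> ?L"
  proof (rule L)
    show "x * y = (u * u' + v * v' * (d * d)) + (u * v' + v * u') * d"
      by (simp add: x y algebra_simps)
  qed (use x y d(2) in \<open>simp_all only: closed\<close>)
qed

text \<open>An odd generator \<open>d\<close> of \<open>E\<close> over \<open>F\<close> lies outside \<open>F'\<close>, since \<open>E\<close> and \<open>F'\<close> meet in \<open>F\<close>. Thus
  \<open>F' + F' d\<close> is a field containing \<open>E\<close> and \<open>F'\<close>, and it must be the compositum.\<close>

lemma compositum_odd_generator:
  fixes F E F' :: "'a::field_char_0 set"
  assumes FE: "quadratic_extension F E" and F': "subfield F' type_ring" "F \<subseteq> F'" "E \<inter> F' = F"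
    and compositum: "generate_field type_ring (E \<union> F') = UNIV"
    and \<sigma>: "galois_involution F E \<sigma>"
  obtains d where "d \<in> E" "\<sigma> d = - d" "d \<noteq> 0"
    "\<And>x. \<exists>u\<in>F'. \<exists>v\<in>F'. x = u + v * d"
proof -
  obtain d where d: "d \<in> E" "d \<notin> F" "d * d \<in> F" "\<sigma> d = - d"
    using quadratic_extension_odd_generator[OF FE \<sigma>] by metis
  let ?L = "{u + v * d | u v. u \<in> F' \<and> v \<in> F'}"
  have "d \<notin> F'"
    using d F' by auto
  then have L: "subfield ?L type_ring"
    using d F' by (intro type_subfield_adjoin_sqrt) auto
  have "E \<subseteq> ?L"
  proof
    fix x assume "x \<in> E"
    then obtain u v where "u \<in> F" "v \<in> F" "x = u + v * d"
      using quadratic_extension_basis[OF FE d(1,2)] by metis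
    then show "x \<in> ?L"
      using F'(2) by auto
  qed
  moreover have "F' \<subseteq> ?L"
  proof
    fix x assume "x \<in> F'"
    then have "x = x + 0 * d \<and> x \<in> F' \<and> 0 \<in> F'"
      using type_subfield_closed(1)[OF F'(1)] by simp
    then show "x \<in> ?L"
      by blast
  qed
  ultimately have "generate_field type_ring (E \<union> F') \<subseteq> ?L"
    using L by (intro field.generate_field_min_subfield1[OF field_from_type_algebra])
      (simp_all add: type_ring_simps)
  then have "x \<in> ?L" for x
    using compositum by auto
  then have "\<exists>u\<in>F'. \<exists>v\<in>F'. x = u + v * d" for x
    by blast
  moreover have "d \<noteq> 0"
    using \<open>d \<notin> F'\<close> type_subfield_closed(1)[OF F'(1)] by auto
  ultimately show thesis
    using d that by metis
qed

lemma quadratic_field_involution: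
  fixes K L :: "'a::field_char_0 set"
  assumes quad: "quadratic_extension K L" and s: "galois_involution K L s" and x: "x \<in> L"
  shows "s (s x) = x"
proof -
  obtain d where d: "d \<in> L" "d \<notin> K" "s d = - d"
    using quadratic_extension_odd_generator[OF quad s] by metis
  have K: "subfield K type_ring" and L: "subfield L type_ring" and sub: "K \<subseteq> L"
    using quad by (auto simp: quadratic_extension_def)
  note L_closed = type_subfield_closed[OF L]
  obtain u v where uv: "u \<in> K" "v \<in> K" "x = u + v * d"
    using quadratic_extension_basis[OF quad d(1,2) x] by metis
  have s_basis: "s (u + v * e) = u + v * s e" if "e \<in> L" for e
    using galois_involution_hom[OF s] galois_involution_fixes[OF s] uv(1,2) subsetD[OF sub] that
    by (simp add: L_closed)
  have "s 0 = 0"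
    using galois_involution_fixes[OF s] type_subfield_closed(1)[OF K] by simp
  then have "s (- d) = d"
    using galois_involution_hom(2)[OF s d(1), of "- d"] d(1,3) by (simp add: L_closed)
  then show ?thesis
    by (simp only: uv(3) s_basis[OF d(1)] d(3) s_basis[OF L_closed(4)[OF d(1)]])
qed

text \<open>On \<open>u + v d\<close> with \<open>u\<close> and \<open>v\<close> in \<open>F'\<close>, the automorphism \<open>\<sigma>\<close> changes the sign of \<open>d\<close> only, while
  \<open>\<tau>\<close> fixes \<open>d\<close> and acts on \<open>u\<close> and \<open>v\<close> as an involution of \<open>F'\<close>. Such a \<open>d\<close> exists in both alternatives,
  since also for \<open>F' = F\<close> the fields \<open>E\<close> and \<open>F'\<close> meet in \<open>F\<close>.\<close>

lemma compositum_involutions: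
  fixes F E F' :: "'a::field_char_0 set"
  assumes FE: "quadratic_extension F E"
    and cases: "(F' = F \<and> \<tau> = id) \<or>
      (quadratic_extension F F' \<and> E \<inter> F' = F \<and>
       galois_involution F F' \<tau> \<and> galois_involution E UNIV \<tau>)"
    and compositum: "generate_field type_ring (E \<union> F') = UNIV"
    and \<sigma>: "galois_involution F E \<sigma>" "galois_involution F' UNIV \<sigma>"
  shows "field_involution \<sigma>" "field_involution \<tau>" "\<And>x. \<sigma> (\<tau> x) = \<tau> (\<sigma> x)"
    and "F' = {a. \<sigma> a = a}" "\<exists>d. \<sigma> d \<noteq> d"
proof -
  have F': "subfield F' type_ring" "F \<subseteq> F'" "E \<inter> F' = F"
    using cases FE by (auto simp: quadratic_extension_def)
  obtain d where d: "d \<in> E" "\<sigma> d = - d" "d \<noteq> 0"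
    and basis: "\<And>x. \<exists>u\<in>F'. \<exists>v\<in>F'. x = u + v * d"
    using compositum_odd_generator[OF FE F' compositum \<sigma>(1)] by metis
  have hom: "\<sigma> (x + y) = \<sigma> x + \<sigma> y" "\<sigma> (x * y) = \<sigma> x * \<sigma> y" for x y
    using galois_involution_hom[OF \<sigma>(2)] by auto
  have fixes_F': "\<sigma> x = x" if "x \<in> F'" for x
    using galois_involution_fixes[OF \<sigma>(2) that] .
  have zero: "\<sigma> 0 = 0"
    using fixes_F' type_subfield_closed(1)[OF F'(1)] .
  then have neg: "\<sigma> (- x) = - \<sigma> x" for x
    using hom(1)[of x "- x"] by (simp add: add_eq_0_iff)
  show "field_involution \<sigma>"
  proof
    show "\<sigma> (\<sigma> x) = x" for x
    proof -
      obtain u v where "u \<in> F'" "v \<in> F'" "x = u + v * d"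
        using basis by metis
      then show ?thesis
        by (simp only: hom neg fixes_F' d(2) minus_minus)
    qed
  qed (fact hom)+
  show "F' = {a. \<sigma> a = a}"
  proof (intro equalityI subsetI CollectI)
    fix a assume "a \<in> {a. \<sigma> a = a}"
    moreover obtain u v where "u \<in> F'" "v \<in> F'" "a = u + v * d"
      using basis by metis
    ultimately have "v * d = - (v * d)" "u \<in> F'" "a = u + v * d"
      using d(2) by (auto simp: hom fixes_F')
    then show "a \<in> F'"
      using d(3) by (simp add: equation_minus_iff)
  qed (rule fixes_F')
  have "\<sigma> d \<noteq> d"
    using d by simp
  then show "\<exists>d. \<sigma> d \<noteq> d" ..
  have "field_involution \<tau> \<and> (\<forall>x. \<sigma> (\<tau> x) = \<tau> (\<sigma> x))"
  proof (cases "\<tau> = id")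
    case True
    then show ?thesis
      by (simp add: field_involution_def)
  next
    case False
    with cases have FF': "quadratic_extension F F'" and \<tau>: "galois_involution F F' \<tau>" "galois_involution E UNIV \<tau>"
      by auto
    have hom': "\<tau> (x + y) = \<tau> x + \<tau> y" "\<tau> (x * y) = \<tau> x * \<tau> y" for x y
      using galois_involution_hom[OF \<tau>(2)] by auto
    have "- d \<in> E"
      using d(1) FE type_subfield_closed(4) by (auto simp: quadratic_extension_def)
    then have fixes_d: "\<tau> d = d" "\<tau> (- d) = - d"
      using galois_involution_fixes[OF \<tau>(2)] d(1) by auto
    have \<tau>_F': "\<tau> x \<in> F'" "\<tau> (\<tau> x) = x" if "x \<in> F'" for x
      using galois_involution_hom(1)[OF \<tau>(1) that] quadratic_field_involution[OF FF' \<tau>(1) that] by auto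
    have "\<tau> (\<tau> x) = x \<and> \<sigma> (\<tau> x) = \<tau> (\<sigma> x)" for x
    proof -
      obtain u v where "u \<in> F'" "v \<in> F'" and x: "x = u + v * d"
        using basis by metis
      then have uv: "\<sigma> u = u" "\<sigma> v = v" "\<tau> (\<tau> u) = u" "\<tau> (\<tau> v) = v"
        "\<sigma> (\<tau> u) = \<tau> u" "\<sigma> (\<tau> v) = \<tau> v"
        using \<tau>_F' fixes_F' by auto
      show ?thesis
        unfolding x hom hom' uv fixes_d d(2) by simp
    qed
    then show ?thesis
      using hom' by (simp add: field_involution_def)
  qed
  then show "field_involution \<tau>" "\<And>x. \<sigma> (\<tau> x) = \<tau> (\<sigma> x)"
    by auto
qed


section \<open>Orbits over local fields\<close>

theorem lemma3:
  fixes F E F' :: "'a::field_char_0 set"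
    and \<sigma> \<tau> :: "'a \<Rightarrow> 'a"
    and \<epsilon> :: 'a
    and J :: "'a^'n^'n"
  assumes local_fields: "nonarch_local_field F" "nonarch_local_field E"
    and quadratic: "quadratic_extension F E"
    and cases: "(F' = F \<and> \<tau> = id) \<or>
      (quadratic_extension F F' \<and> E \<inter> F' = F \<and>
       galois_involution F F' \<tau> \<and> galois_involution E UNIV \<tau>)"
    and compositum: "generate_field type_ring (E \<union> F') = UNIV"
    and sigma: "galois_involution F E \<sigma>" "galois_involution F' UNIV \<sigma>"
    and eps: "\<epsilon> \<in> {1, -1}" "\<epsilon> = -1 \<longrightarrow> F' = F \<and> even CARD('n)"
    and J: "J \<in> Y_F F' \<tau> \<epsilon>"
  shows
    "(\<forall>x\<in>X_sp \<sigma> \<tau> J. \<forall>z\<in>GL UNIV. x = z ** matrix_inv (map_matrix \<sigma> z) \<longrightarrow>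
        star \<tau> J z \<in> Y_F F' \<tau> \<epsilon>) \<and>
     (\<exists>f. (\<forall>x\<in>X_sp \<sigma> \<tau> J. \<forall>z\<in>GL UNIV. x = z ** matrix_inv (map_matrix \<sigma> z) \<longrightarrow>
             f (G_orbit \<sigma> \<tau> J x) = star_orbit F' \<tau> (star \<tau> J z)) \<and>
          bij_betw f (G_orbit \<sigma> \<tau> J ` X_sp \<sigma> \<tau> J)
            (star_orbit F' \<tau> ` (star_orbit UNIV \<tau> J \<inter> Y_F F' \<tau> \<epsilon>))) \<and>
     (\<forall>x\<in>X_sp \<sigma> \<tau> J. \<forall>z\<in>GL UNIV. x = z ** matrix_inv (map_matrix \<sigma> z) \<longrightarrow>
        stabilizer_F \<sigma> \<tau> J x =
          {z ** g ** matrix_inv z | g. g \<in> G_F F' \<tau> (star \<tau> J z)})"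
proof -
  note involutions = compositum_involutions[OF quadratic cases compositum sigma]
  have F': "F' = {a. \<sigma> a = a}"
    by (fact involutions(4))
  interpret \<sigma>: field_involution \<sigma>
    by (fact involutions(1))
  interpret \<tau>: field_involution \<tau>
    by (fact involutions(2))
  interpret symmetric_space \<sigma> \<tau> \<epsilon> J
    by unfold_locales (use involutions(3,5) J F' in \<open>auto simp: inj_on_def\<close>)
  show ?thesis
    unfolding F' \<sigma>.coboundary_def[symmetric]
  proof (intro conjI exI ballI impI)
    fix x z
    assume x: "x \<in> X_sp \<sigma> \<tau> J" and z: "z \<in> GL UNIV" and xz: "x = \<sigma>.coboundary z"
    have inv: "invertible z"
      using z by (simp add: GL_UNIV)
    show "star \<tau> J z \<in> Y_F {a. \<sigma> a = a} \<tau> \<epsilon>"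
      using x inv by (simp add: xz coboundary_in_X_iff)
    show "star_image (G_orbit \<sigma> \<tau> J x) = star_orbit {a. \<sigma> a = a} \<tau> (star \<tau> J z)"
      using inv by (simp add: xz star_image_G_orbit)
    show "stabilizer_F \<sigma> \<tau> J x
        = {z ** g ** matrix_inv z | g. g \<in> G_F {a. \<sigma> a = a} \<tau> (star \<tau> J z)}"
      using inv by (simp add: xz stabilizer_coboundary)
  qed (rule bij_betw_star_image)
qed

end
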